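(* Let $f \in \mathcal{K}_S$, $f(z)=z+\sum_{n=2}^{\infty}a_nz^n$, and let $\Gamma_1,\Gamma_2$ be the first two inverse logarithmic coefficients of $f$. Then $$|\Gamma_2|-|\Gamma_1|\le \frac16 .$$ The inequality is sharp, i.e. there exists $f\in\mathcal{K}_S$ for which equality holds.
   Context: Let $\mathbb{D}=\{z\in\mathbb{C}:|z|<1\}$. $\mathcal{A}$ denotes the class of functions $f$ analytic in $\mathbb{D}$ with $f(0)=0$ and $f'(0)=1$, so $f(z)=z+\sum_{n=2}^\infty a_n z^n$. The class $\mathcal{K}_S$ (convex functions with respect to symmetric points) consists of all $f\in\mathcal{A}$ such that $$\operatorname{Re}\left(\frac{(zf'(z))'}{(f(z)-f(-z))'}\right)>0,\qquad z\in\mathbb{D},$$ where $'$ denotes differentiation with respect to $z$; thus $(f(z)-f(-z))'=f'(z)+f'(-z)$. For $f\in\mathcal{A}$, let $f^{-1}$ be its local inverse near the origin with $f^{-1}(0)=0$. The inverse logarithmic coefficients $\Gamma_n$ of $f$ are defined by $$\log\frac{f^{-1}(w)}{w}=2\sum_{n=1}^\infty \Gamma_n w^n$$ for $w$ in a neighborhood of $0$, with the branch of the logarithm satisfying $\log 1=0$. In terms of the Taylor coefficients of $f$, $\Gamma_1=-\frac12 a_2$ and $\Gamma_2=-\frac12 a_3+\frac34 a_2^2$. *)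

theory Defs
  imports "HOL-Complex_Analysis.Complex_Analysis"
begin

(* Members of the classes are total functions of type complex => complex; only their
   values on the open unit disc matter. *)

definition class_A :: "(complex \<Rightarrow> complex) set" where
  "class_A = {f. f holomorphic_on ball 0 1 \<and> f 0 = 0 \<and> deriv f 0 = 1}"

(* Since x / 0 = 0 in HOL, positivity of the real part forces the denominator to be nonzero. *)
definition class_KS :: "(complex \<Rightarrow> complex) set" where
  "class_KS = {f \<in> class_A. \<forall>z\<in>ball 0 1.
     Re (deriv (\<lambda>u. u * deriv f u) z / deriv (\<lambda>u. f u - f (- u)) z) > 0}"

definition local_inverse_at_0 :: "(complex \<Rightarrow> complex) \<Rightarrow> (complex \<Rightarrow> complex) \<Rightarrow> bool" where
  "local_inverse_at_0 f g \<longleftrightarrow> g analytic_on {0} \<and> g 0 = 0 \<and>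
     (\<forall>\<^sub>F w in nhds 0. f (g w) = w) \<and> (\<forall>\<^sub>F z in nhds 0. g (f z) = z)"

(* g w / w tends to 1 as w tends to 0, so near 0 the principal branch Ln is the branch of the
   logarithm with log 1 = 0.  The coefficients are those with index at least 1; setting the
   entry with index 0 to 0 makes the sequence unique. *)
definition has_inverse_log_coeffs :: "(complex \<Rightarrow> complex) \<Rightarrow> (nat \<Rightarrow> complex) \<Rightarrow> bool" where
  "has_inverse_log_coeffs f \<Gamma> \<longleftrightarrow> \<Gamma> 0 = 0 \<and>
     (\<exists>g. local_inverse_at_0 f g \<and>
        (\<forall>\<^sub>F w in at 0. (\<lambda>n. 2 * (\<Gamma> n * w ^ n)) sums Ln (g w / w)))"

definition inverse_log_coeff :: "(complex \<Rightarrow> complex) \<Rightarrow> nat \<Rightarrow> complex" where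
  "inverse_log_coeff f = (THE \<Gamma>. has_inverse_log_coeffs f \<Gamma>)"

lemma local_inverse_at_0_exists:
  assumes "f \<in> class_A"
  obtains g where "local_inverse_at_0 f g" "deriv g 0 = 1"
proof -
  have hol: "f holomorphic_on ball 0 1" and f0: "f 0 = 0" and d: "deriv f 0 = 1"
    using assms by (auto simp: class_A_def)
  obtain r where r: "r > 0" "ball 0 r \<subseteq> ball (0::complex) 1" "open (f ` ball 0 r)" "inj_on f (ball 0 r)"
    by (rule has_complex_derivative_locally_invertible[OF hol, of 0]) (use d in auto)
  obtain g where g: "g holomorphic_on (f ` ball 0 r)"
      "\<And>z. z \<in> ball 0 r \<Longrightarrow> deriv f z * deriv g (f z) = 1"
      "\<And>z. z \<in> ball 0 r \<Longrightarrow> g (f z) = z"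
    using holomorphic_has_inverse[OF holomorphic_on_subset[OF hol r(2)] open_ball r(4)] by blast
  have 0: "0 \<in> ball 0 r" and 1: "0 \<in> f ` ball 0 r"
    using r(1) f0 by (auto intro!: image_eqI[of _ _ 0])
  have "g analytic_on {0}"
    using g(1) r(3) 1 analytic_at by blast
  moreover have "g 0 = 0"
    using g(3)[OF 0] f0 by simp
  moreover have "\<forall>\<^sub>F w in nhds 0. f (g w) = w"
    using eventually_nhds_in_open[OF r(3) 1] by eventually_elim (use g(3) in auto)
  moreover have "\<forall>\<^sub>F z in nhds 0. g (f z) = z"
    using eventually_nhds_in_open[OF open_ball 0] by eventually_elim (use g(3) in auto)
  moreover have "deriv g 0 = 1"
    using g(2)[OF 0] f0 d by simp
  ultimately show ?thesis
    using that unfolding local_inverse_at_0_def by blast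
qed

lemma local_inverse_at_0_unique:
  assumes "local_inverse_at_0 f g" "local_inverse_at_0 f h"
  shows "\<forall>\<^sub>F w in nhds 0. g w = h w"
proof -
  have "h analytic_on {0}" "h 0 = 0" and fh: "\<forall>\<^sub>F w in nhds 0. f (h w) = w"
    and gf: "\<forall>\<^sub>F z in nhds 0. g (f z) = z"
    using assms unfolding local_inverse_at_0_def by auto
  then have "filterlim h (nhds 0) (nhds 0)"
    using analytic_at_imp_isCont[of h 0] tendsto_at_iff_tendsto_nhds[of h 0]
    by (simp add: continuous_at)
  from eventually_compose_filterlim[OF gf this] fh show ?thesis
    by eventually_elim auto
qed

lemma has_inverse_log_coeffs_exists:
  assumes "f \<in> class_A"
  shows "\<exists>\<Gamma>. has_inverse_log_coeffs f \<Gamma>"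
proof -
  obtain g where g: "local_inverse_at_0 f g" and dg: "deriv g 0 = 1"
    using local_inverse_at_0_exists[OF assms] .
  have an: "g analytic_on {0}" and g0: "g 0 = 0"
    using g by (auto simp: local_inverse_at_0_def)
  define q where "q = (\<lambda>w. if w = 0 then 1 else g w / w)"
  have "q analytic_on {0}"
    by (rule pole_theorem_analytic_0[where g = g and a = 0])
       (use an g0 dg in \<open>auto simp: q_def intro!: exI[of _ 1]\<close>)
  moreover have "Ln analytic_on {q 0}"
    unfolding q_def by (auto intro!: analytic_intros)
  ultimately have "(Ln \<circ> q) analytic_on {0}"
    by (intro analytic_on_compose) auto
  then obtain F where F: "(Ln \<circ> q) has_fps_expansion F"
    using analytic_at_imp_has_fps_expansion_0 by blast
  have F0: "fps_nth F 0 = 0"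
    using has_fps_expansion_imp_0_eq_fps_nth_0[OF F] by (simp add: q_def)
  have conv: "fps_conv_radius F > 0" and ev: "\<forall>\<^sub>F w in nhds 0. eval_fps F w = (Ln \<circ> q) w"
    using F by (auto simp: has_fps_expansion_def)
  have "\<forall>\<^sub>F w::complex in at 0. w \<in> eball 0 (fps_conv_radius F)"
    using conv eventually_nhds_in_open[of "eball 0 (fps_conv_radius F)" "0::complex"]
    by (auto simp: eventually_at_filter zero_ereal_def in_eball_iff elim!: eventually_mono)
  moreover have "\<forall>\<^sub>F w in at 0. eval_fps F w = (Ln \<circ> q) w"
    using ev by (auto simp: eventually_at_filter elim: eventually_mono)
  moreover have "\<forall>\<^sub>F w::complex in at 0. w \<noteq> 0"
    by (simp add: eventually_at_filter)
  ultimately have "\<forall>\<^sub>F w in at 0. (\<lambda>n. 2 * (fps_nth F n / 2 * w ^ n)) sums Ln (g w / w)"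
  proof eventually_elim
    case (elim w)
    then have "(\<lambda>n. fps_nth F n * w ^ n) sums eval_fps F w"
      by (intro sums_eval_fps) (auto simp: in_eball_iff)
    then show ?case
      using elim by (simp add: q_def)
  qed
  then have "has_inverse_log_coeffs f (\<lambda>n. fps_nth F n / 2)"
    using g F0 by (auto simp: has_inverse_log_coeffs_def)
  then show ?thesis by blast
qed

lemma has_inverse_log_coeffs_unique:
  assumes "has_inverse_log_coeffs f \<Gamma>" "has_inverse_log_coeffs f \<Delta>"
  shows "\<Gamma> = \<Delta>"
proof -
  obtain g where g: "local_inverse_at_0 f g" and \<Gamma>0: "\<Gamma> 0 = 0"
      and 1: "\<forall>\<^sub>F w in at 0. (\<lambda>n. 2 * (\<Gamma> n * w ^ n)) sums Ln (g w / w)"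
    using assms(1) unfolding has_inverse_log_coeffs_def by blast
  obtain h where h: "local_inverse_at_0 f h" and \<Delta>0: "\<Delta> 0 = 0"
      and 2: "\<forall>\<^sub>F w in at 0. (\<lambda>n. 2 * (\<Delta> n * w ^ n)) sums Ln (h w / w)"
    using assms(2) unfolding has_inverse_log_coeffs_def by blast
  define L where "L = (\<lambda>w. if w = 0 then 0 else Ln (g w / w))"
  have s0: "(\<lambda>n. c n * 0 ^ n) sums c 0" for c :: "nat \<Rightarrow> complex"
    using powser_sums_zero by blast
  have "\<forall>\<^sub>F w in nhds 0. (\<lambda>n. fps_nth (Abs_fps (\<lambda>n. 2 * \<Gamma> n)) n * w ^ n) sums L w"
    using 1 unfolding eventually_at_filter
    by eventually_elim (use \<Gamma>0 s0[of "\<lambda>n. 2 * \<Gamma> n"] in \<open>auto simp: L_def mult.assoc\<close>)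
  then have "L has_fps_expansion Abs_fps (\<lambda>n. 2 * \<Gamma> n)"
    by (rule has_fps_expansionI)
  moreover have "\<forall>\<^sub>F w in nhds 0. (\<lambda>n. fps_nth (Abs_fps (\<lambda>n. 2 * \<Delta> n)) n * w ^ n) sums L w"
    using 2 local_inverse_at_0_unique[OF g h] unfolding eventually_at_filter
    by eventually_elim (use \<Delta>0 s0[of "\<lambda>n. 2 * \<Delta> n"] in \<open>auto simp: L_def mult.assoc\<close>)
  then have "L has_fps_expansion Abs_fps (\<lambda>n. 2 * \<Delta> n)"
    by (rule has_fps_expansionI)
  ultimately have "Abs_fps (\<lambda>n. 2 * \<Gamma> n) = Abs_fps (\<lambda>n. 2 * \<Delta> n)"
    by (rule fps_expansion_unique_complex)
  then show ?thesis
    by (auto simp: fps_eq_iff)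
qed

lemma has_inverse_log_coeffs_inverse_log_coeff:
  assumes "f \<in> class_A"
  shows "has_inverse_log_coeffs f (inverse_log_coeff f)"
  unfolding inverse_log_coeff_def
  using has_inverse_log_coeffs_exists[OF assms] has_inverse_log_coeffs_unique
  by (metis theI)

end

theory Submission
  imports Defs
begin

text \<open>
  Write \<open>f z = z + a\<^sub>2 z^2 + a\<^sub>3 z^3 + \<dots>\<close>. Comparing coefficients in \<open>f (g w) = w\<close> and in
  \<open>g w = w exp (2 \<Gamma>\<^sub>1 w + 2 \<Gamma>\<^sub>2 w^2 + \<dots>)\<close>, where \<open>g\<close> is the local inverse of \<open>f\<close>, gives
  \<open>\<Gamma>\<^sub>1 = - a\<^sub>2 / 2\<close> and \<open>\<Gamma>\<^sub>2 = - a\<^sub>3 / 2 + 3 a\<^sub>2^2 / 4\<close> (lemma \<open>inverse_log_coeff_1_2\<close>).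

  Let \<open>N z = (z f' z)'\<close> and \<open>D z = (f z - f (-z))'\<close>. The defining condition \<open>Re (N / D) > 0\<close> of
  the class says that the Cayley transform \<open>\<omega> = (2 N - D) / (2 N + D)\<close> maps the disc into
  itself. Its expansion starts with \<open>\<omega> z = 2 a\<^sub>2 z + (3 a\<^sub>3 - 4 a\<^sub>2^2) z^2\<close>, and all Taylor
  coefficients of \<open>\<omega>\<close> have modulus at most 1 by the Cauchy estimates. As
  \<open>\<Gamma>\<^sub>2 = - (3 a\<^sub>3 - 4 a\<^sub>2^2) / 6 + a\<^sub>2^2 / 12\<close>, it follows that
  \<open>|\<Gamma>\<^sub>2| - |\<Gamma>\<^sub>1| \<le> 1/6 + |a\<^sub>2|^2 / 12 - |a\<^sub>2| / 2 \<le> 1/6\<close>, because \<open>|a\<^sub>2| \<le> 1/2\<close>.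

  Equality holds for the inverse hyperbolic tangent \<open>z + z^3/3 + \<dots>\<close>, which is odd with
  derivative \<open>1 / (1 - z^2)\<close>: here \<open>N / D = (1 + z^2) / (2 (1 - z^2))\<close>, \<open>\<Gamma>\<^sub>1 = 0\<close> and
  \<open>\<Gamma>\<^sub>2 = - 1/6\<close>.
\<close>

section \<open>Taylor coefficients of bounded functions\<close>

lemma norm_fps_nth_le_1:
  fixes \<omega> :: "complex \<Rightarrow> complex"
  assumes hol: "\<omega> holomorphic_on ball 0 1" and bound: "\<And>z. z \<in> ball 0 1 \<Longrightarrow> norm (\<omega> z) \<le> 1"
    and W: "\<omega> has_fps_expansion W"
  shows "norm (fps_nth W n) \<le> 1"
proof -
  have nth: "fps_nth W n = (deriv ^^ n) \<omega> 0 / fact n"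
    using fps_nth_fps_expansion[OF W] .
  have est: "norm (fps_nth W n) * r ^ n \<le> 1" if r: "0 < r" "r < 1" for r
  proof -
    have "norm ((deriv ^^ n) \<omega> 0) \<le> fact n * 1 / r ^ n"
    proof (rule Cauchy_inequality)
      show "\<omega> holomorphic_on ball 0 r" "continuous_on (cball 0 r) \<omega>"
        using r by (auto intro!: holomorphic_on_imp_continuous_on intro: holomorphic_on_subset[OF hol])
    qed (use r in \<open>auto intro!: bound\<close>)
    then show ?thesis
      using r by (simp add: nth norm_divide field_simps)
  qed
  have "((\<lambda>r::real. norm (fps_nth W n) * r ^ n) \<longlongrightarrow> norm (fps_nth W n) * 1 ^ n) (at_left 1)"
    by (intro tendsto_intros)
  moreover have "\<forall>\<^sub>F r in at_left 1. norm (fps_nth W n) * r ^ n \<le> 1"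
    using eventually_at_left_real[of 0 "1::real"] by (auto elim!: eventually_mono intro: est)
  ultimately have "norm (fps_nth W n) * 1 ^ n \<le> 1"
    by (intro tendsto_upperbound) auto
  then show ?thesis by simp
qed

section \<open>The first two inverse logarithmic coefficients\<close>

lemma class_A_fps:
  assumes "f \<in> class_A"
  obtains F where "f has_fps_expansion F" "fps_nth F 0 = 0" "fps_nth F 1 = 1"
proof -
  have f: "f holomorphic_on ball 0 1" "f 0 = 0" "deriv f 0 = 1"
    using assms by (auto simp: class_A_def)
  then have "f analytic_on {0}"
    using analytic_at by (metis open_ball centre_in_ball zero_less_one)
  then obtain F where F: "f has_fps_expansion F"
    using analytic_at_imp_has_fps_expansion_0 by blast
  show ?thesis
    using that[OF F] f fps_nth_fps_expansion[OF F, of 0] fps_nth_fps_expansion[OF F, of 1] by simp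
qed

lemma inverse_log_coeff_1_2:
  assumes A: "f \<in> class_A" and F: "f has_fps_expansion F"
  shows "inverse_log_coeff f 1 = - fps_nth F 2 / 2"
    and "inverse_log_coeff f 2 = - fps_nth F 3 / 2 + 3 / 4 * (fps_nth F 2)\<^sup>2"
proof -
  obtain F' where "f has_fps_expansion F'" "fps_nth F' 0 = 0" "fps_nth F' 1 = 1"
    using class_A_fps[OF A] .
  then have F01: "fps_nth F 0 = 0" "fps_nth F (Suc 0) = 1"
    using fps_expansion_unique_complex[OF F] by auto
  define \<Gamma> where "\<Gamma> = inverse_log_coeff f"
  obtain g where g: "local_inverse_at_0 f g" and \<Gamma>0: "\<Gamma> 0 = 0"
      and sums: "\<forall>\<^sub>F w in at 0. (\<lambda>n. 2 * (\<Gamma> n * w ^ n)) sums Ln (g w / w)"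
    using has_inverse_log_coeffs_inverse_log_coeff[OF A]
    unfolding has_inverse_log_coeffs_def \<Gamma>_def by blast
  have g0: "g 0 = 0" and fg: "\<forall>\<^sub>F w in nhds 0. f (g w) = w" and gan: "g analytic_on {0}"
    using g by (auto simp: local_inverse_at_0_def)
  obtain G where G: "g has_fps_expansion G"
    using gan analytic_at_imp_has_fps_expansion_0 by blast
  have G0: "fps_nth G 0 = 0"
    using fps_nth_fps_expansion[OF G, of 0] g0 by simp
  define L where "L = (\<lambda>w. if w = 0 then 0 else Ln (g w / w))"
  define H where "H = Abs_fps (\<lambda>n. 2 * \<Gamma> n)"
  have s0: "(\<lambda>n. c n * 0 ^ n) sums c 0" for c :: "nat \<Rightarrow> complex"
    using powser_sums_zero by blast
  have "\<forall>\<^sub>F w in nhds 0. (\<lambda>n. fps_nth H n * w ^ n) sums L w"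
    using sums unfolding eventually_at_filter
    by eventually_elim (use \<Gamma>0 s0[of "\<lambda>n. 2 * \<Gamma> n"] in \<open>auto simp: L_def H_def mult.assoc\<close>)
  then have L: "L has_fps_expansion H"
    by (rule has_fps_expansionI)
  have H0: "fps_nth H 0 = 0"
    using \<Gamma>0 by (simp add: H_def)
  \<comment> \<open>Near 0 the inverse \<open>g\<close> vanishes at 0 only, so there \<open>exp (L w)\<close> really is \<open>g w / w\<close>.\<close>
  have "\<forall>\<^sub>F w in nhds 0. w * exp (L w) = g w"
    using fg
  proof eventually_elim
    case (elim w)
    then have "g w \<noteq> 0" if "w \<noteq> 0"
      using that A by (auto simp: class_A_def)
    then show ?case
      using g0 by (cases "w = 0") (simp_all add: L_def)
  qed
  moreover have "(\<lambda>w. w * (exp \<circ> L) w) has_fps_expansion fps_X * (fps_exp 1 oo H)"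
    by (intro has_fps_expansion_mult has_fps_expansion_fps_X
        has_fps_expansion_compose[OF has_fps_expansion_exp1 L H0])
  ultimately have "g has_fps_expansion fps_X * (fps_exp 1 oo H)"
    by (subst (asm) has_fps_expansion_cong) auto
  then have GH: "G = fps_X * (fps_exp 1 oo H)"
    using G fps_expansion_unique_complex by blast
  have "(f \<circ> g) has_fps_expansion (F oo G)"
    using has_fps_expansion_compose[OF F G G0] .
  moreover have "(\<lambda>w. w) has_fps_expansion fps_X"
    by (rule fps_expansion_intros)
  ultimately have FG: "F oo G = fps_X"
    using fg by (subst (asm) has_fps_expansion_cong[OF _ refl, where g = "\<lambda>w. w"])
      (auto intro: fps_expansion_unique_complex)
  have G1: "fps_nth G (Suc 0) = 1"
    and G2: "fps_nth G 2 = 2 * \<Gamma> 1"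
    and G3: "fps_nth G 3 = 2 * \<Gamma> 2 + 2 * (\<Gamma> 1)\<^sup>2"
    unfolding GH using \<Gamma>0
    by (simp_all add: fps_compose_nth H_def eval_nat_numeral fps_mult_nth field_simps)
  have "fps_nth (F oo G) 2 = fps_nth G 2 + fps_nth F 2"
    "fps_nth (F oo G) 3 = fps_nth G 3 + 2 * fps_nth F 2 * fps_nth G 2 + fps_nth F 3"
    using F01 G0 G1 by (simp_all add: fps_compose_nth eval_nat_numeral fps_mult_nth algebra_simps)
  then have e2: "2 * \<Gamma> 1 + fps_nth F 2 = 0"
    and e3: "2 * \<Gamma> 2 + 2 * (\<Gamma> 1)\<^sup>2 + 2 * fps_nth F 2 * (2 * \<Gamma> 1) + fps_nth F 3 = 0"
    by (simp_all add: FG G2 G3)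
  show \<Gamma>1: "inverse_log_coeff f 1 = - fps_nth F 2 / 2"
    using e2 unfolding \<Gamma>_def by (simp add: field_simps eq_neg_iff_add_eq_0)
  show "inverse_log_coeff f 2 = - fps_nth F 3 / 2 + 3 / 4 * (fps_nth F 2)\<^sup>2"
    using e3 \<Gamma>1 unfolding \<Gamma>_def by (simp add: field_simps power2_eq_square; algebra)
qed

section \<open>The inequality\<close>

lemma deriv_diff_reflect:
  assumes "f holomorphic_on ball 0 1" "z \<in> ball 0 (1::real)"
  shows "deriv (\<lambda>u. f u - f (- u)) z = deriv f z + deriv f (- z)"
proof (rule DERIV_imp_deriv)
  have d: "(f has_field_derivative deriv f x) (at x)" if "x \<in> ball 0 1" for x
    using assms(1) that holomorphic_derivI by blast
  show "((\<lambda>u. f u - f (- u)) has_field_derivative deriv f z + deriv f (- z)) (at z)"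
    using assms(2) by (auto intro!: derivative_eq_intros d DERIV_chain2[where f = f, OF d])
qed

text \<open>The two quantities are the coefficients of \<open>z\<close> and \<open>z^2\<close> in the Cayley transform
  \<open>(2 N / D - 1) / (2 N / D + 1)\<close>, which is holomorphic and bounded by 1 on the disc because
  \<open>Re (N / D) > 0\<close>.\<close>

lemma class_KS_coeff_bounds:
  assumes KS: "f \<in> class_KS" and F: "f has_fps_expansion F"
  shows "norm (2 * fps_nth F 2) \<le> 1"
    and "norm (3 * fps_nth F 3 - 4 * (fps_nth F 2)\<^sup>2) \<le> 1"
proof -
  have A: "f \<in> class_A"
    using KS by (simp add: class_KS_def)
  then have hol: "f holomorphic_on ball 0 1"
    by (simp add: class_A_def)
  obtain F' where "f has_fps_expansion F'" "fps_nth F' 0 = 0" "fps_nth F' 1 = 1"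
    using class_A_fps[OF A] .
  then have F01: "fps_nth F 0 = 0" "fps_nth F (Suc 0) = 1"
    using fps_expansion_unique_complex[OF F] by auto
  define N where "N = deriv (\<lambda>u. u * deriv f u)"
  define D where "D = deriv (\<lambda>u. f u - f (- u))"
  define \<omega> where "\<omega> = (\<lambda>z. (2 * (N z / D z) - 1) / (2 * (N z / D z) + 1))"
  have pos: "Re (N z / D z) > 0" if "z \<in> ball 0 1" for z
    using KS that by (simp add: class_KS_def N_def D_def)
  have D0: "D z \<noteq> 0" if "z \<in> ball 0 1" for z
    using pos[OF that] by auto
  have cayley0: "2 * (N z / D z) + 1 \<noteq> 0" if "z \<in> ball 0 1" for z
  proof
    assume "2 * (N z / D z) + 1 = 0"
    then have "N z / D z = - 1 / 2"
      by (simp add: field_simps add_eq_0_iff)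
    then show False
      using pos[OF that] by (simp only:) simp
  qed
  have holr: "(\<lambda>u. f (- u)) holomorphic_on ball 0 1"
    using holomorphic_on_compose_gen[of uminus "ball 0 1" f "ball 0 1"] hol
    by (simp add: o_def holomorphic_on_minus image_subset_iff)
  have "N holomorphic_on ball 0 1" "D holomorphic_on ball 0 1"
    unfolding N_def D_def by (auto intro!: holomorphic_intros hol holr)
  then have \<omega>hol: "\<omega> holomorphic_on ball 0 1"
    unfolding \<omega>_def by (intro holomorphic_intros) (use D0 cayley0 in auto)
  have \<omega>bound: "norm (\<omega> z) \<le> 1" if "z \<in> ball 0 1" for z
  proof -
    define q where "q = N z / D z"
    have "(2 * Re q - 1)\<^sup>2 \<le> (2 * Re q + 1)\<^sup>2"
      using pos[OF that] by (simp add: q_def[symmetric] power2_eq_square algebra_simps)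
    then have "norm (2 * q - 1) \<le> norm (2 * q + 1)"
      by (simp add: cmod_def)
    moreover have "2 * q + 1 \<noteq> 0"
      using cayley0[OF that] unfolding q_def .
    ultimately have "norm ((2 * q - 1) / (2 * q + 1)) \<le> 1"
      by (simp add: norm_divide divide_le_eq)
    then show ?thesis
      by (simp only: \<omega>_def q_def)
  qed
  have "\<omega> analytic_on {0}"
    using \<omega>hol analytic_at by (metis open_ball centre_in_ball zero_less_one)
  then obtain W where W: "\<omega> has_fps_expansion W"
    using analytic_at_imp_has_fps_expansion_0 by blast
  \<comment> \<open>The coefficients of \<open>\<omega>\<close> are read off from \<open>\<omega> (2 N + D) = 2 N - D\<close>.\<close>
  define FN where "FN = fps_deriv (fps_X * fps_deriv F)"
  define FD where "FD = fps_deriv (F - (F oo - fps_X))"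
  have FN: "N has_fps_expansion FN"
    unfolding N_def FN_def by (intro fps_expansion_intros F)
  have "(f \<circ> uminus) has_fps_expansion (F oo - fps_X)"
    by (rule has_fps_expansion_compose) (auto intro!: fps_expansion_intros F)
  then have FD: "D has_fps_expansion FD"
    unfolding D_def FD_def o_def by (intro fps_expansion_intros F)
  have "(\<lambda>z. \<omega> z * (2 * N z + D z)) has_fps_expansion W * (fps_const 2 * FN + FD)"
    by (intro fps_expansion_intros W FN FD)
  moreover have "(\<lambda>z. 2 * N z - D z) has_fps_expansion fps_const 2 * FN - FD"
    by (intro fps_expansion_intros FN FD)
  moreover have "\<forall>\<^sub>F z in nhds 0. \<omega> z * (2 * N z + D z) = 2 * N z - D z"
    using eventually_nhds_in_open[of "ball 0 1" "0::complex"]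
  proof (rule eventually_mono)
    fix z :: complex assume "z \<in> ball 0 1"
    from D0[OF this] cayley0[OF this] show "\<omega> z * (2 * N z + D z) = 2 * N z - D z"
      by (simp add: \<omega>_def divide_simps)
  qed auto
  ultimately have eq: "W * (fps_const 2 * FN + FD) = fps_const 2 * FN - FD"
    by (subst (asm) has_fps_expansion_cong[OF _ refl, where g = "\<lambda>z. 2 * N z - D z"])
      (auto intro: fps_expansion_unique_complex)
  have refl: "F oo - fps_X = Abs_fps (\<lambda>n. (-1) ^ n * fps_nth F n)"
    using fps_compose_uminus'[of F] .
  have cN: "fps_nth FN 0 = 1" "fps_nth FN (Suc 0) = 4 * fps_nth F 2" "fps_nth FN 2 = 9 * fps_nth F 3"
    using F01 by (simp_all add: FN_def eval_nat_numeral)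
  have cD: "fps_nth FD 0 = 2" "fps_nth FD (Suc 0) = 0" "fps_nth FD 2 = 6 * fps_nth F 3"
    using F01 by (simp_all add: FD_def refl eval_nat_numeral)
  have "fps_nth W 0 = 0"
    using arg_cong[OF eq, of "\<lambda>h. fps_nth h 0"] by (simp add: cN cD)
  moreover from this have W1: "fps_nth W 1 = 2 * fps_nth F 2"
    using arg_cong[OF eq, of "\<lambda>h. fps_nth h 1"] by (simp add: fps_mult_nth cN cD)
  moreover have "fps_nth W 0 * (2 * fps_nth FN 2 + fps_nth FD 2)
      + fps_nth W 1 * (2 * fps_nth FN (Suc 0) + fps_nth FD (Suc 0))
      + fps_nth W 2 * (2 * fps_nth FN 0 + fps_nth FD 0) = 2 * fps_nth FN 2 - fps_nth FD 2"
    using arg_cong[OF eq, of "\<lambda>h. fps_nth h 2"] by (simp add: fps_mult_nth numeral_2_eq_2)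
  ultimately have "4 * fps_nth W 2 = 4 * (3 * fps_nth F 3 - 4 * (fps_nth F 2)\<^sup>2)"
    by (simp add: cN cD power2_eq_square algebra_simps)
  then have W2: "fps_nth W 2 = 3 * fps_nth F 3 - 4 * (fps_nth F 2)\<^sup>2"
    by (subst (asm) mult_cancel_left) simp
  have "norm (fps_nth W n) \<le> 1" for n
    using norm_fps_nth_le_1[OF \<omega>hol \<omega>bound W] .
  from this[of 1] this[of 2] show "norm (2 * fps_nth F 2) \<le> 1"
    and "norm (3 * fps_nth F 3 - 4 * (fps_nth F 2)\<^sup>2) \<le> 1"
    by (simp_all only: W1 W2)
qed

lemma class_KS_inverse_log_coeff_bound:
  assumes KS: "f \<in> class_KS"
  shows "norm (inverse_log_coeff f 2) - norm (inverse_log_coeff f 1) \<le> 1 / 6"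
proof -
  have A: "f \<in> class_A"
    using KS by (simp add: class_KS_def)
  obtain F where F: "f has_fps_expansion F"
    using class_A_fps[OF A] by blast
  define a where "a = fps_nth F 2"
  define b where "b = 3 * fps_nth F 3 - 4 * a\<^sup>2"
  have a: "norm a \<le> 1 / 2" and b: "norm b \<le> 1"
    using class_KS_coeff_bounds[OF KS F] by (auto simp: a_def b_def norm_mult)
  have "inverse_log_coeff f 2 = a\<^sup>2 / 12 - b / 6"
    using inverse_log_coeff_1_2(2)[OF A F] unfolding a_def b_def by (simp only:) (simp add: field_simps)
  then have "norm (inverse_log_coeff f 2) \<le> norm (a\<^sup>2 / 12) + norm (b / 6)"
    by (simp only: norm_triangle_ineq4)
  also have "\<dots> = norm a * norm a / 12 + norm b / 6"
    by (simp add: norm_divide norm_mult power2_eq_square)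
  also have "\<dots> \<le> norm a / 2 + 1 / 6"
    using mult_left_mono[OF a, of "norm a"] b norm_ge_zero[of a] by linarith
  finally show ?thesis
    using inverse_log_coeff_1_2(1)[OF A F] by (simp add: a_def norm_divide)
qed

section \<open>The extremal function\<close>

lemma Re_moebius_pos:
  fixes w :: complex
  assumes "norm w < 1"
  shows "Re ((1 + w) / (1 - w)) > 0"
proof -
  have "w \<noteq> 1" using assms by auto
  have "(norm w)\<^sup>2 < 1"
    using assms by (simp add: power_less_one_iff abs_square_less_1)
  then have "(Re w)\<^sup>2 + (Im w)\<^sup>2 < 1"
    by (simp add: cmod_power2)
  moreover have "(1 - Re w)\<^sup>2 + (Im w)\<^sup>2 > 0"
    using \<open>w \<noteq> 1\<close> by (auto simp: complex_eq_iff sum_power2_gt_zero_iff)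
  ultimately show ?thesis
    by (auto simp: Re_divide power2_eq_square algebra_simps intro!: divide_pos_pos)
qed

lemma has_field_derivative_artanh_complex:
  fixes z :: complex
  assumes "norm z < 1"
  shows "(artanh has_field_derivative 1 / (1 - z\<^sup>2)) (at z)"
proof -
  have nz: "1 + z \<noteq> 0" "1 - z \<noteq> 0"
    using assms by (auto simp: add_eq_0_iff)
  have slit: "(1 + z) / (1 - z) \<notin> \<real>\<^sub>\<le>\<^sub>0"
    using Re_moebius_pos[OF assms] by (auto simp: complex_nonpos_Reals_iff)
  have "((\<lambda>u. (1 + u) / (1 - u)) has_field_derivative 2 / (1 - z)\<^sup>2) (at z)"
    using nz by (auto intro!: derivative_eq_intros simp: power2_eq_square)
  then have "((\<lambda>u. Ln ((1 + u) / (1 - u)) / 2) has_field_derivative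
      inverse ((1 + z) / (1 - z)) * (2 / (1 - z)\<^sup>2) / 2) (at z)"
    by (intro DERIV_cdivide DERIV_chain2[where f = Ln and g = "\<lambda>u. (1 + u) / (1 - u)", OF has_field_derivative_Ln[OF slit]])
  moreover have "inverse (a / b) * (2 / b\<^sup>2) / 2 = 1 / (a * b)" if "a \<noteq> 0" "b \<noteq> 0" for a b :: complex
    using that by (simp add: power2_eq_square field_simps)
  note this[OF nz]
  moreover have "(1 + z) * (1 - z) = 1 - z\<^sup>2"
    by (simp add: power2_eq_square algebra_simps)
  ultimately show ?thesis
    by (simp add: artanh_def[abs_def])
qed

lemma artanh_class_KS: "(artanh :: complex \<Rightarrow> complex) \<in> class_KS"
proof -
  note D = has_field_derivative_artanh_complex
  have hol: "(artanh :: complex \<Rightarrow> complex) holomorphic_on ball 0 1"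
    using D by (auto simp: holomorphic_on_open intro!: exI)
  have d: "deriv artanh z = 1 / (1 - z\<^sup>2)" if "norm z < 1" for z :: complex
    using D[OF that] by (rule DERIV_imp_deriv)
  have "Re (deriv (\<lambda>u. u * deriv artanh u) z /
      deriv (\<lambda>u. artanh u - artanh (- u)) z) > 0" if z: "z \<in> ball 0 1" for z
  proof -
    have z2: "norm (z\<^sup>2) < 1"
      using z by (simp add: norm_power power_less_one_iff)
    then have nz: "1 - z\<^sup>2 \<noteq> 0"
      by auto
    have "\<forall>\<^sub>F u in nhds z. u * deriv artanh u = u / (1 - u\<^sup>2)"
      using eventually_nhds_in_open[OF open_ball z] by eventually_elim (simp add: d)
    then have "deriv (\<lambda>u. u * deriv artanh u) z = deriv (\<lambda>u. u / (1 - u\<^sup>2)) z"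
      by (intro deriv_cong_ev refl)
    also have "\<dots> = (1 + z\<^sup>2) / (1 - z\<^sup>2)\<^sup>2"
      using nz by (intro DERIV_imp_deriv)
        (auto intro!: derivative_eq_intros simp: power2_eq_square algebra_simps)
    finally have "deriv (\<lambda>u. u * deriv artanh u) z /
        deriv (\<lambda>u. artanh u - artanh (- u)) z = (1 + z\<^sup>2) / (1 - z\<^sup>2) / 2"
      using nz z by (simp add: deriv_diff_reflect[OF hol z] d power2_eq_square[of "1 - z\<^sup>2"])
    moreover have "Re ((1 + z\<^sup>2) / (1 - z\<^sup>2) / 2) = Re ((1 + z\<^sup>2) / (1 - z\<^sup>2)) / 2"
      by (rule Re_divide_numeral)
    ultimately show ?thesis
      using Re_moebius_pos[OF z2] by simp
  qed
  moreover have "artanh (0 :: complex) = 0"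
    by (simp add: artanh_def)
  ultimately show ?thesis
    using hol d[of 0] by (simp add: class_KS_def class_A_def)
qed

lemma artanh_inverse_log_coeffs:
  shows "inverse_log_coeff artanh 1 = 0" "inverse_log_coeff artanh 2 = - 1 / 6"
proof -
  have A: "(artanh :: complex \<Rightarrow> complex) \<in> class_A"
    using artanh_class_KS by (simp add: class_KS_def)
  obtain F where F: "(artanh :: complex \<Rightarrow> complex) has_fps_expansion F" and F1: "fps_nth F 1 = 1"
    using class_A_fps[OF A] by blast
  have "(\<lambda>z. deriv artanh z * (1 - z ^ 2)) has_fps_expansion fps_deriv F * (1 - fps_X ^ 2)"
    by (intro fps_expansion_intros F)
  moreover have "(\<lambda>_. 1 :: complex) has_fps_expansion 1"
    by (rule fps_expansion_intros)
  moreover have "\<forall>\<^sub>F z in nhds (0::complex). deriv artanh z * (1 - z ^ 2) = 1"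
    using eventually_nhds_in_open[of "ball 0 1" "0::complex"]
  proof (rule eventually_mono)
    fix z :: complex assume "z \<in> ball 0 1"
    then have z: "norm z < 1" by simp
    have "norm (z\<^sup>2) < 1"
      using z by (simp add: norm_power power_less_one_iff)
    then have "1 - z\<^sup>2 \<noteq> 0" by auto
    then show "deriv artanh z * (1 - z ^ 2) = 1"
      by (simp add: DERIV_imp_deriv[OF has_field_derivative_artanh_complex[OF z]])
  qed auto
  ultimately have eq: "fps_deriv F * (1 - fps_X ^ 2) = 1"
    by (subst (asm) has_fps_expansion_cong[OF _ refl, where g = "\<lambda>_. 1"])
      (auto intro: fps_expansion_unique_complex)
  have F2: "fps_nth F 2 = 0"
    using arg_cong[OF eq, of "\<lambda>h. fps_nth h 1"]
    by (simp add: fps_mult_nth fps_X_power_nth eval_nat_numeral)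
  have F3: "fps_nth F 3 = 1 / 3"
    using arg_cong[OF eq, of "\<lambda>h. fps_nth h 2"] F1
    by (simp add: fps_mult_nth fps_X_power_nth eval_nat_numeral field_simps)
  show "inverse_log_coeff artanh 1 = 0"
    unfolding inverse_log_coeff_1_2(1)[OF A F] by (simp add: F2)
  show "inverse_log_coeff artanh 2 = - 1 / 6"
    using inverse_log_coeff_1_2(2)[OF A F] by (simp add: F2 F3)
qed

theorem theorem2p2:
  shows "(\<forall>f\<in>class_KS. norm (inverse_log_coeff f 2) - norm (inverse_log_coeff f 1) \<le> 1 / 6) \<and>
         (\<exists>f\<in>class_KS. norm (inverse_log_coeff f 2) - norm (inverse_log_coeff f 1) = 1 / 6)"
proof (intro conjI ballI bexI)
  show "norm (inverse_log_coeff artanh 2) - norm (inverse_log_coeff artanh 1) = 1 / 6"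
    by (simp only: artanh_inverse_log_coeffs) simp
qed (use class_KS_inverse_log_coeff_bound artanh_class_KS in auto)

end
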